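(* Let $r>0$, $\mathbf{x}_0\in\mathbb{R}^n$, $I=B_r(\mathbf{x}_0)\subset\mathbb{R}^n$, and let $\mathbf{F}:I\to\mathbb{R}^n$ be a map of class $C^1$ such that $\mathbf{F}(\mathbf{x}_0)=\mathbf{x}_0$ and all the eigenvalues $\lambda_1,\dots,\lambda_n$ of $D\mathbf{F}(\mathbf{x}_0)$ lie inside the unit circle, that is, $|\lambda_i|<1$ for $i=1,\dots,n$. For $\mathbf{x}_1\in B_r(\mathbf{x}_0)$ let $S(\mathbf{x}_1)=(\mathbf{x}_j)_{j\in\mathbb{N}}$ be the orbit of the discrete dynamical system generated by $\mathbf{x}_{j+1}=\mathbf{F}(\mathbf{x}_j)$ with initial point $\mathbf{x}_1$. Then there exists $r_1<r$, $r_1>0$, such that for every $\mathbf{x}_1\in B_{r_1}(\mathbf{x}_0)$ we have $\dim_B S(\mathbf{x}_1)=0$.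
   Context: $B_r(\mathbf{x}_0)$ is the open ball of radius $r$ centred at $\mathbf{x}_0$. An orbit is identified with its set of points. Box dimension: for a bounded set $A\subset\mathbb{R}^N$ let $A_\varepsilon=\{y\in\mathbb{R}^N: d(y,A)<\varepsilon\}$ and let $|A_\varepsilon|$ be its Lebesgue measure. For $s\ge 0$ put $\mathcal{M}_*^s(A)=\liminf_{\varepsilon\to0}|A_\varepsilon|/\varepsilon^{N-s}$ and $\mathcal{M}^{*s}(A)=\limsup_{\varepsilon\to0}|A_\varepsilon|/\varepsilon^{N-s}$. The lower and upper box dimensions are $\underline{\dim}_B A=\inf\{s>0:\mathcal{M}_*^s(A)=0\}$ and $\overline{\dim}_B A=\inf\{s>0:\mathcal{M}^{*s}(A)=0\}$; if they coincide, the common value is denoted $\dim_B A$. The assertion $\dim_B A=d$ includes that both coincide. The assertion that the orbit has a box dimension includes that the orbit is well defined for all $j\in\mathbb{N}$. *)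

theory Defs
  imports "HOL-Analysis.Analysis"
begin

definition C1_on :: "('a::real_normed_vector \<Rightarrow> 'b::real_normed_vector) \<Rightarrow> 'a set \<Rightarrow> bool" where
  "C1_on f S \<longleftrightarrow> (\<exists>f' :: 'a \<Rightarrow> 'a \<Rightarrow>\<^sub>L 'b.
     (\<forall>x\<in>S. (f has_derivative blinfun_apply (f' x)) (at x)) \<and> continuous_on S f')"
  \<comment> \<open>intended for open \<open>S\<close> only: differentiability at \<open>x\<close> is not relative to \<open>S\<close>\<close>

text \<open>Eigenvalues of a real matrix are understood over the complex numbers.\<close>

definition complex_eigenvalue :: "real ^ 'n ^ 'n \<Rightarrow> complex \<Rightarrow> bool" where
  "complex_eigenvalue A l \<longleftrightarrow>
     (\<exists>v :: complex ^ 'n. v \<noteq> 0 \<and> map_matrix complex_of_real A *v v = l *s v)"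

definition orbit_points :: "('a \<Rightarrow> 'a) \<Rightarrow> 'a \<Rightarrow> 'a set" where
  "orbit_points F x = range (\<lambda>j. (F ^^ j) x)"

text \<open>The guard \<open>A \<noteq> {}\<close> is needed because \<^term>\<open>infdist y {} = 0\<close>.\<close>

definition eps_nbhd :: "real \<Rightarrow> 'a::metric_space set \<Rightarrow> 'a set" where
  "eps_nbhd e A = {y. A \<noteq> {} \<and> infdist y A < e}"

definition lower_content :: "real \<Rightarrow> 'a::euclidean_space set \<Rightarrow> ennreal" where
  "lower_content s A = Liminf (at_right 0)
     (\<lambda>e. emeasure lebesgue (eps_nbhd e A) / ennreal (e powr (real DIM('a) - s)))"

definition upper_content :: "real \<Rightarrow> 'a::euclidean_space set \<Rightarrow> ennreal" where
  "upper_content s A = Limsup (at_right 0)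
     (\<lambda>e. emeasure lebesgue (eps_nbhd e A) / ennreal (e powr (real DIM('a) - s)))"

text \<open>The infima are taken in \<^typ>\<open>ereal\<close>, so that the infimum of the empty set is \<open>\<infinity>\<close>.\<close>

definition lower_box_dim :: "'a::euclidean_space set \<Rightarrow> ereal" where
  "lower_box_dim A = Inf {ereal s | s. s > 0 \<and> lower_content s A = 0}"

definition upper_box_dim :: "'a::euclidean_space set \<Rightarrow> ereal" where
  "upper_box_dim A = Inf {ereal s | s. s > 0 \<and> upper_content s A = 0}"

definition has_box_dim :: "'a::euclidean_space set \<Rightarrow> real \<Rightarrow> bool" where
  "has_box_dim A d \<longleftrightarrow> bounded A \<and> lower_box_dim A = ereal d \<and> upper_box_dim A = ereal d"

end

theory Submission
  imports Defs "HOL-Computational_Algebra.Fundamental_Theorem_Algebra" "HOL-Real_Asymp.Real_Asymp"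
begin

text \<open>
  Every vector \<open>v\<close> is annihilated by \<open>p(A)\<close> for some polynomial \<open>p \<noteq> 0\<close>. Linear factors of \<open>p\<close> at
  non-eigenvalues can be cancelled, and each remaining factor gives a recursion
  \<open>a\<^sub>j\<^sub>+\<^sub>1 = l a\<^sub>j + b\<^sub>j\<close> with \<open>cmod l < 1\<close>; hence the powers of \<open>A = DF(x\<^sub>0)\<close> tend to \<open>0\<close> and some
  iterate of \<open>F\<close> contracts a neighbourhood of \<open>x\<^sub>0\<close> towards \<open>x\<^sub>0\<close>. Orbits therefore converge
  geometrically, so \<open>O(log (1/e))\<close> balls of radius \<open>2e\<close> cover the \<open>e\<close>-neighbourhood of an orbit, and
  \<open>e powr s * log (1/e)\<close> tends to \<open>0\<close> for every \<open>s > 0\<close>.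
\<close>

section \<open>Powers of a matrix with spectrum in the open unit disc\<close>

text \<open>This is \<open>p(A) v\<close>, evaluated by Horner's scheme, so that only matrix-vector
  products occur and no matrix powers have to be formed.\<close>

definition poly_act :: "'a::field ^ 'n ^ 'n \<Rightarrow> 'a poly \<Rightarrow> 'a ^ 'n \<Rightarrow> 'a ^ 'n" where
  "poly_act A p v = fold_coeffs (\<lambda>a w. a *s v + A *v w) p 0"

lemma poly_act_0 [simp]: "poly_act A 0 v = 0"
  by (simp add: poly_act_def)

lemma poly_act_pCons [simp]: "poly_act A (pCons a p) v = a *s v + A *v poly_act A p v"
  by (cases "p = 0 \<and> a = 0") (auto simp: poly_act_def)

lemma poly_act_add: "poly_act A (p + q) v = poly_act A p v + poly_act A q v"
proof (induction p arbitrary: q)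
  case (pCons a p)
  obtain b q' where "q = pCons b q'" by (cases q)
  then show ?case
    using pCons.IH by (simp add: matrix_vector_right_distrib vec.scale_left_distrib)
qed simp

lemma poly_act_sum: "poly_act A (\<Sum>i\<in>I. p i) v = (\<Sum>i\<in>I. poly_act A (p i) v)"
  by (induction I rule: infinite_finite_induct) (auto simp: poly_act_add)

lemma poly_act_monom: "poly_act A (monom c k) v = c *s (((*v) A ^^ k) v)"
  by (induction k) (auto simp: monom_0 monom_Suc vec.scale)

lemma poly_act_smult: "poly_act A (smult c p) v = c *s poly_act A p v"
  by (induction p) (auto simp: vec.scale_right_distrib vec.scale)

lemma poly_act_mult: "poly_act A (p * q) v = poly_act A p (poly_act A q v)"
  by (induction p) (auto simp: poly_act_add poly_act_smult)

text \<open>A dimension count: one more iterate of \<open>v\<close> than the dimension forces a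
  nontrivial linear relation, whose coefficients are those of \<open>p\<close>. The dimension and
  the relation are real, which suffices for a nonzero \<open>p\<close>.\<close>

lemma ex_annihilating_poly:
  fixes A :: "complex ^ 'n ^ 'n"
  shows "\<exists>p. p \<noteq> 0 \<and> poly_act A p v = 0"
proof -
  define u where "u = (\<lambda>i. ((*v) A ^^ i) v)"
  show ?thesis
  proof (cases "inj u")
    \<comment> \<open>Linear dependence is stated for sets, which forget repetitions, so a repeated
      iterate is treated apart: it gives the polynomial X^i - X^j.\<close>
    case False
    then obtain i j where ij: "u i = u j" "i \<noteq> j" by (auto simp: inj_def)
    define p :: "complex poly" where "p = monom 1 i + monom (-1) j"
    have "coeff p i = 1" using ij by (simp add: p_def)
    then have "p \<noteq> 0" by auto
    moreover have "poly_act A p v = 0"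
      using ij by (simp add: p_def poly_act_add poly_act_monom u_def)
    ultimately show ?thesis by blast
  next
    case True
    let ?d = "DIM(complex ^ 'n)"
    have "card (u ` {..?d}) = Suc ?d"
      using True by (subst card_image) (auto intro: inj_on_subset)
    then have "dependent (u ` {..?d})"
      by (intro dependent_biggerset) auto
    then obtain c where c: "\<exists>w\<in>u ` {..?d}. c w \<noteq> 0" "(\<Sum>w\<in>u ` {..?d}. c w *\<^sub>R w) = 0"
      by (subst (asm) dependent_finite) auto
    then obtain k where k: "k \<le> ?d" "c (u k) \<noteq> 0" by auto
    define p where "p = (\<Sum>i\<le>?d. monom (complex_of_real (c (u i))) i)"
    have "coeff p k = c (u k)"
      using k by (simp add: p_def coeff_sum)
    then have "p \<noteq> 0" using k by auto
    moreover have "poly_act A p v = (\<Sum>i\<le>?d. c (u i) *\<^sub>R u i)"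
      unfolding p_def poly_act_sum poly_act_monom u_def
      by (intro sum.cong) (auto simp: vec_eq_iff scaleR_conv_of_real[where 'a = complex])
    moreover have "\<dots> = 0"
      using c(2) True by (subst (asm) sum.reindex) (auto intro: inj_on_subset)
    ultimately show ?thesis by auto
  qed
qed

text \<open>The perturbation is eventually so small that the level \<open>e / 2\<close> reproduces
  itself under the recursion, while the excess above it decays like \<open>q ^ j\<close>.\<close>

lemma affine_recursion_tendsto_0:
  fixes a b :: "nat \<Rightarrow> 'a::real_normed_vector"
  assumes rec: "\<And>j. norm (a (Suc j)) \<le> q * norm (a j) + norm (b j)"
    and q: "0 \<le> q" "q < 1" and b: "b \<longlonglongrightarrow> 0"
  shows "a \<longlonglongrightarrow> 0"
proof (rule LIMSEQ_I)
  fix e :: real assume e: "e > 0"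
  \<comment> \<open>Chosen so that \<open>q * (e / 2) + d = e / 2\<close>.\<close>
  define d where "d = e * (1 - q) / 2"
  have d: "d > 0" using e q by (simp add: d_def)
  then obtain N where N: "\<And>j. j \<ge> N \<Longrightarrow> norm (b j) < d"
    using LIMSEQ_D[OF b d] by auto
  have bound: "norm (a (N + j)) \<le> q ^ j * norm (a N) + e / 2" for j
  proof (induction j)
    case 0
    then show ?case using e by simp
  next
    case (Suc j)
    have "norm (a (N + Suc j)) \<le> q * norm (a (N + j)) + norm (b (N + j))"
      using rec[of "N + j"] by simp
    also have "\<dots> \<le> q * (q ^ j * norm (a N) + e / 2) + d"
      using Suc q N[of "N + j"] by (intro add_mono mult_left_mono) auto
    also have "\<dots> = q ^ Suc j * norm (a N) + e / 2"
      by (simp add: d_def field_simps)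
    finally show ?case .
  qed
  have "(\<lambda>j. q ^ j * norm (a N)) \<longlonglongrightarrow> 0"
    using q by (intro tendsto_mult_left_zero LIMSEQ_power_zero) auto
  then obtain M where M: "\<And>j. j \<ge> M \<Longrightarrow> q ^ j * norm (a N) < e / 2"
    using LIMSEQ_D[of _ 0 "e / 2"] e q by fastforce
  have "norm (a n - 0) < e" if "n \<ge> N + M" for n
    using bound[of "n - N"] M[of "n - N"] that by (simp add: le_diff_conv2)
  then show "\<exists>no. \<forall>n\<ge>no. norm (a n - 0) < e" by blast
qed

section \<open>Convergence of matrix iterates to zero, first over the complex numbers, then over the
  reals\<close>

lemma norm_vec_scale: "norm (c *s v) = cmod c * norm v" for v :: "complex ^ 'n"
  by (simp add: norm_vec_def norm_mult L2_set_right_distrib)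

text \<open>Induction on the degree with \<open>v\<close> arbitrary, since the induction hypothesis
  is applied to \<open>v\<close> itself in one case and to \<open>A *v v - l *s v\<close> in the
  other.\<close>

lemma matrix_powers_tendsto_0_aux:
  fixes A :: "complex ^ 'n ^ 'n"
  assumes ev: "\<And>l v. v \<noteq> 0 \<Longrightarrow> A *v v = l *s v \<Longrightarrow> cmod l < 1"
    and "p \<noteq> 0" "poly_act A p v = 0"
  shows "(\<lambda>j. ((*v) A ^^ j) v) \<longlonglongrightarrow> 0"
  using assms(2,3)
proof (induction "degree p" arbitrary: p v)
  case 0
  then obtain c where "p = [:c:]" by (metis degree_eq_zeroE)
  with 0 have v: "v = 0" by simp
  have "((*v) A ^^ j) 0 = 0" for j by (induction j) auto
  then show ?case unfolding v by simp
next
  case (Suc k)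
  from Suc.hyps(2) obtain l where "poly p l = 0"
    using fundamental_theorem_of_algebra[of p] by (auto simp: constant_degree)
  then obtain q where q: "p = [:-l, 1:] * q" by (auto simp: poly_eq_0_iff_dvd)
  with Suc.prems have "q \<noteq> 0" by auto
  then have deg: "k = degree q"
    using Suc.hyps(2) unfolding q by (subst (asm) degree_mult_eq) auto
  have lin: "poly_act A [:-l, 1:] w = A *v w - l *s w" for w
    by simp
  \<comment> \<open>The two factors commute: in one order, \<open>poly_act A q v\<close> is zero or
    an eigenvector for \<open>l\<close>; in the other, \<open>q\<close> annihilates
    \<open>A *v v - l *s v\<close>.\<close>
  have pq: "A *v poly_act A q v - l *s poly_act A q v = 0"
    using Suc.prems(2) unfolding q poly_act_mult lin .
  have qp: "poly_act A q (A *v v - l *s v) = 0"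
    using Suc.prems(2) unfolding q mult.commute[of _ q] poly_act_mult lin .
  show ?case
  proof (cases "cmod l < 1")
    case False
    \<comment> \<open>Here \<open>cmod l\<close> is at least 1, so \<open>ev\<close> excludes an
      eigenvector and \<open>q\<close>, of smaller degree, already annihilates
      \<open>v\<close>.\<close>
    then have "poly_act A q v = 0"
      using ev[of "poly_act A q v" l] pq by auto
    then show ?thesis using Suc.hyps(1)[OF deg] \<open>q \<noteq> 0\<close> by auto
  next
    case True
    let ?w = "A *v v - l *s v"
    have w: "(\<lambda>j. ((*v) A ^^ j) ?w) \<longlonglongrightarrow> 0"
      using Suc.hyps(1)[OF deg \<open>q \<noteq> 0\<close> qp] .
    have "((*v) A ^^ Suc j) v = l *s ((*v) A ^^ j) v + ((*v) A ^^ j) ?w" for j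
      by (induction j) (simp_all add: matrix_vector_right_distrib vec.scale)
    then have "norm (((*v) A ^^ Suc j) v) \<le>
        cmod l * norm (((*v) A ^^ j) v) + norm (((*v) A ^^ j) ?w)" for j
      by (metis norm_triangle_ineq norm_vec_scale)
    then show ?thesis
      using True by (intro affine_recursion_tendsto_0[OF _ _ _ w]) auto
  qed
qed

text \<open>Complexification: the coordinatewise embedding \<open>?c\<close> preserves norms and
  intertwines \<open>A\<close> with \<open>?A\<close>, so the complex decay descends to real
  vectors.\<close>

lemma matrix_powers_tendsto_0:
  fixes A :: "real ^ 'n ^ 'n"
  assumes ev: "\<And>l. complex_eigenvalue A l \<Longrightarrow> cmod l < 1"
  shows "(\<lambda>j. ((*v) A ^^ j) x) \<longlonglongrightarrow> 0"
proof -
  let ?A = "map_matrix complex_of_real A"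
  let ?c = "\<lambda>x::real^'n. (\<chi> i. complex_of_real (x $ i)) :: complex ^ 'n"
  obtain p where p: "p \<noteq> 0" "poly_act ?A p (?c x) = 0"
    using ex_annihilating_poly by blast
  have lim: "(\<lambda>j. ((*v) ?A ^^ j) (?c x)) \<longlonglongrightarrow> 0"
    by (rule matrix_powers_tendsto_0_aux[OF _ p]) (use ev in \<open>auto simp: complex_eigenvalue_def\<close>)
  have "?A *v ?c y = ?c (A *v y)" for y
    by (simp add: vec_eq_iff matrix_vector_mult_def map_matrix_def)
  then have eq: "((*v) ?A ^^ j) (?c x) = ?c (((*v) A ^^ j) x)" for j
    by (induction j) auto
  have "norm (?c y) = norm y" for y
    by (simp add: norm_vec_def)
  with tendsto_norm_zero[OF lim] show ?thesis
    by (simp add: eq tendsto_norm_zero_iff)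
qed

text \<open>In finite dimension the summed norms of the images of the basis vectors bound the
  operator norm, so pointwise convergence gives a uniform estimate.\<close>

lemma linear_family_uniformly_small:
  fixes f :: "nat \<Rightarrow> 'a::euclidean_space \<Rightarrow> 'b::real_normed_vector"
  assumes lin: "\<And>j. linear (f j)" and lim: "\<And>x. (\<lambda>j. f j x) \<longlonglongrightarrow> 0" and "e > 0"
  shows "\<forall>\<^sub>F j in sequentially. \<forall>x. norm (f j x) \<le> e * norm x"
proof -
  have "(\<lambda>j. \<Sum>b\<in>Basis. norm (f j b)) \<longlonglongrightarrow> (\<Sum>b\<in>(Basis :: 'a set). 0)"
    by (intro tendsto_sum tendsto_norm_zero lim)
  then have "\<forall>\<^sub>F j in sequentially. (\<Sum>b\<in>Basis. norm (f j b)) < e"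
    using \<open>e > 0\<close> by (intro order_tendstoD(2)[of _ 0]) auto
  then show ?thesis
  proof eventually_elim
    case (elim j)
    show ?case
    proof
      fix x :: 'a
      have "f j x = f j (\<Sum>b\<in>Basis. (x \<bullet> b) *\<^sub>R b)"
        by (simp add: euclidean_representation)
      also have "\<dots> = (\<Sum>b\<in>Basis. (x \<bullet> b) *\<^sub>R f j b)"
        using lin by (simp add: linear_sum linear_cmul)
      also have "norm \<dots> \<le> (\<Sum>b\<in>Basis. norm x * norm (f j b))"
        by (intro sum_norm_le) (auto intro!: mult_right_mono Basis_le_norm)
      also have "\<dots> = (\<Sum>b\<in>Basis. norm (f j b)) * norm x"
        by (simp add: sum_distrib_left mult.commute)
      also have "\<dots> \<le> e * norm x"
        using elim by (intro mult_right_mono) auto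
      finally show "norm (f j x) \<le> e * norm x" .
    qed
  qed
qed

section \<open>Geometric convergence of orbits\<close>

lemma funpow_has_derivative_at_fixpoint:
  assumes "F x0 = x0" "(F has_derivative L) (at x0)"
  shows "(F ^^ j has_derivative L ^^ j) (at x0)"
proof (induction j)
  case 0
  show ?case by (simp add: id_def)
next
  case (Suc j)
  have "(F ^^ j) x0 = x0" using assms(1) by (induction j) auto
  with diff_chain_at[OF Suc, of F L] assms(2) show ?case
    by (simp only: funpow.simps)
qed

text \<open>A bound on the derivative passes to the map near the fixed point at the cost of
  \<open>e\<close>, which absorbs the first-order remainder.\<close>

lemma has_derivative_eventually_dist_le:
  assumes der: "(G has_derivative L) (at x0)" and "G x0 = x0"
    and L: "\<And>h. norm (L h) \<le> K * norm h" and "e > 0"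
  shows "\<forall>\<^sub>F x in nhds x0. dist (G x) x0 \<le> (K + e) * dist x x0"
proof -
  obtain d where d: "d > 0"
    "\<And>y. norm (y - x0) < d \<Longrightarrow> norm (G y - G x0 - L (y - x0)) \<le> e * norm (y - x0)"
    using der \<open>e > 0\<close> unfolding has_derivative_at_alt by blast
  have "dist (G x) x0 \<le> (K + e) * dist x x0" if "dist x x0 < d" for x
  proof -
    have "norm (G x - x0) \<le> norm (G x - x0 - L (x - x0)) + norm (L (x - x0))"
      using norm_triangle_ineq[of "G x - x0 - L (x - x0)" "L (x - x0)"] by simp
    also have "\<dots> \<le> e * norm (x - x0) + K * norm (x - x0)"
      using d(2)[of x] that assms(2) L by (intro add_mono) (auto simp: dist_norm)
    finally show ?thesis by (simp add: dist_norm algebra_simps)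
  qed
  then show ?thesis using d(1) unfolding eventually_nhds_metric by blast
qed

text \<open>\<open>F\<close> itself may at first increase the distance to \<open>x0\<close>; only an
  iterate \<open>F ^^ m\<close> is known to contract. Hence the exponent \<open>j div m\<close>,
  while \<open>K\<close> pays for the remaining \<open>j mod m\<close> steps.\<close>

lemma orbits_converge_geometrically:
  fixes F :: "'a::real_normed_vector \<Rightarrow> 'a"
  assumes fp: "F x0 = x0" and der: "(F has_derivative L) (at x0)"
    and small: "\<forall>\<^sub>F j in sequentially. \<forall>h. norm ((L ^^ j) h) \<le> 1 / 2 * norm h"
  obtains m d K where "m > 0" "d > 0" "K > 0"
    "\<And>x j. dist x x0 < d \<Longrightarrow> dist ((F ^^ j) x) x0 \<le> K * (3 / 4) ^ (j div m) * dist x x0"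
proof -
  obtain N where N: "\<And>j h. j \<ge> N \<Longrightarrow> norm ((L ^^ j) h) \<le> 1 / 2 * norm h"
    using small by (auto simp: eventually_sequentially)
  \<comment> \<open>\<open>Suc\<close> ensures \<open>m > 0\<close> and keeps \<open>m\<close>
    beyond the threshold \<open>N\<close>.\<close>
  define m where "m = Suc N"
  have fixp: "(F ^^ j) x0 = x0" for j using fp by (induction j) auto
  have "\<exists>B. \<forall>h. norm ((L ^^ i) h) \<le> B * norm h" for i
    using bounded_linear.bounded[OF has_derivative_bounded_linear[OF
        funpow_has_derivative_at_fixpoint[OF fp der]], of i]
    by (metis mult.commute)
  then obtain B where B: "\<And>i h. norm ((L ^^ i) h) \<le> B i * norm h" by metis
  \<comment> \<open>Absolute values because \<open>B i\<close> may be negative; the summand 1 covers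
    the loss \<open>e = 1\<close> in the estimates of \<open>F ^^ i\<close> below.\<close>
  define K where "K = (\<Sum>i<m. \<bar>B i\<bar>) + 1"
  have K: "K > 0" unfolding K_def by (intro add_nonneg_pos sum_nonneg) auto
  have contr: "\<forall>\<^sub>F x in nhds x0. dist ((F ^^ m) x) x0 \<le> (1 / 2 + 1 / 4) * dist x x0"
    by (rule has_derivative_eventually_dist_le[OF funpow_has_derivative_at_fixpoint[OF fp der] fixp N])
       (simp_all add: m_def)
  have "\<forall>\<^sub>F x in nhds x0. dist ((F ^^ i) x) x0 \<le> (B i + 1) * dist x x0" for i
    by (rule has_derivative_eventually_dist_le[OF funpow_has_derivative_at_fixpoint[OF fp der] fixp B]) simp
  then have "\<forall>\<^sub>F x in nhds x0. \<forall>i\<in>{..<m}. dist ((F ^^ i) x) x0 \<le> (B i + 1) * dist x x0"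
    by (simp add: eventually_ball_finite)
  with contr have "\<forall>\<^sub>F x in nhds x0. dist ((F ^^ m) x) x0 \<le> (1 / 2 + 1 / 4) * dist x x0 \<and>
      (\<forall>i\<in>{..<m}. dist ((F ^^ i) x) x0 \<le> (B i + 1) * dist x x0)"
    by (rule eventually_conj)
  then obtain d where d: "d > 0"
    and dm: "\<And>x. dist x x0 < d \<Longrightarrow> dist ((F ^^ m) x) x0 \<le> (3 / 4) * dist x x0"
    and di: "\<And>x i. dist x x0 < d \<Longrightarrow> i < m \<Longrightarrow> dist ((F ^^ i) x) x0 \<le> (B i + 1) * dist x x0"
    unfolding eventually_nhds_metric by auto
  have "B i \<le> (\<Sum>i<m. \<bar>B i\<bar>)" if "i < m" for i
    using member_le_sum[of i "{..<m}" "\<lambda>i. \<bar>B i\<bar>"] that by auto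
  then have diK: "dist ((F ^^ i) x) x0 \<le> K * dist x x0" if "dist x x0 < d" "i < m" for x i
    using di[OF that] that by (smt (verit) K_def mult_right_mono zero_le_dist)
  have iter: "dist ((F ^^ (m * k)) x) x0 \<le> (3 / 4) ^ k * dist x x0" if "dist x x0 < d" for x k
  proof (induction k)
    case (Suc k)
    \<comment> \<open>The contraction is available only within distance \<open>d\<close>, so each
      iterate has to be shown to stay there.\<close>
    have "(3 / 4) ^ k * dist x x0 \<le> 1 * dist x x0"
      by (intro mult_right_mono power_le_one) auto
    with Suc that have "dist ((F ^^ (m * k)) x) x0 < d" by simp
    from dm[OF this] Suc show ?case by (simp add: funpow_add)
  qed simp
  show thesis
  proof (rule that[of m d K])
    fix x j assume x: "dist x x0 < d"
    let ?y = "(F ^^ (m * (j div m))) x"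
    have "(3 / 4) ^ (j div m) * dist x x0 \<le> 1 * dist x x0"
      by (intro mult_right_mono power_le_one) auto
    with iter[OF x, of "j div m"] x have "dist ?y x0 < d" by simp
    then have "dist ((F ^^ (j mod m)) ?y) x0 \<le> K * dist ?y x0"
      by (intro diK) (auto simp: m_def)
    also have "\<dots> \<le> K * ((3 / 4) ^ (j div m) * dist x x0)"
      using K iter[OF x] by (intro mult_left_mono) auto
    also have "(F ^^ (j mod m)) ?y = (F ^^ (j mod m + m * (j div m))) x"
      by (simp only: funpow_add comp_apply)
    finally show "dist ((F ^^ j) x) x0 \<le> K * (3 / 4) ^ (j div m) * dist x x0"
      by (simp add: mult.assoc)
  qed (use d K in \<open>auto simp: m_def\<close>)
qed

section \<open>Box dimension of a geometrically convergent sequence\<close>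

text \<open>Both contents then vanish for each \<open>s > 0\<close>, so both dimensions become the
  infimum of all positive reals.\<close>

lemma has_box_dim_0I:
  fixes A :: "'a::euclidean_space set"
  assumes "bounded A"
    and lim: "\<And>s. s > 0 \<Longrightarrow> ((\<lambda>e. emeasure lebesgue (eps_nbhd e A) /
      ennreal (e powr (real DIM('a) - s))) \<longlongrightarrow> 0) (at_right 0)"
  shows "has_box_dim A 0"
proof -
  have *: "lower_content s A = 0" "upper_content s A = 0" if "s > 0" for s
    unfolding lower_content_def upper_content_def
    using lim[OF that] by (simp_all add: lim_imp_Liminf lim_imp_Limsup)
  have "Inf {ereal s |s. s > 0} = ereal 0"
  proof (rule antisym)
    show "Inf {ereal s |s. s > 0} \<le> ereal 0"
    proof (rule ereal_le_epsilon2)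
      fix e :: real assume "e > 0"
      then show "Inf {ereal s |s. s > 0} \<le> ereal 0 + ereal e"
        by (intro Inf_lower) auto
    qed
  qed (auto intro!: Inf_greatest)
  moreover have "{ereal s |s. s > 0 \<and> lower_content s A = 0} = {ereal s |s. s > 0}"
    "{ereal s |s. s > 0 \<and> upper_content s A = 0} = {ereal s |s. s > 0}"
    using * by auto
  ultimately show ?thesis
    using \<open>bounded A\<close> by (simp add: has_box_dim_def lower_box_dim_def upper_box_dim_def)
qed

text \<open>One ball around \<open>p\<close> serves the whole tail, since its radius
  \<open>2 * e\<close> has room for two distances below \<open>e\<close>; each of the first
  \<open>N\<close> terms gets its own ball.\<close>

lemma emeasure_eps_nbhd_le:
  fixes x :: "nat \<Rightarrow> 'a::euclidean_space"
  assumes e: "e > 0" and tail: "\<And>j. j \<ge> N \<Longrightarrow> dist (x j) p < e"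
  shows "emeasure lebesgue (eps_nbhd e (range x)) \<le>
    ennreal ((real N + 1) * (unit_ball_vol (real DIM('a)) * (2 * e) ^ DIM('a)))"
proof -
  define v where "v = unit_ball_vol (real DIM('a)) * (2 * e) ^ DIM('a)"
  have v: "v \<ge> 0" using e by (simp add: v_def)
  have ball: "emeasure lebesgue (ball c (2 * e)) = ennreal v" for c :: 'a
    using e by (simp add: v_def emeasure_ball)
  let ?U = "(\<Union>c\<in>insert p (x ` {..<N}). ball c (2 * e))"
  have "eps_nbhd e (range x) \<subseteq> ?U"
  proof
    fix y assume "y \<in> eps_nbhd e (range x)"
    \<comment> \<open>The infimum need not be attained, but the strict inequality still yields a
      term at distance below \<open>e\<close>.\<close>
    then have "(INF a\<in>range x. dist y a) < e" by (simp add: eps_nbhd_def infdist_notempty)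
    then obtain j where j: "dist y (x j) < e"
      by (subst (asm) cINF_less_iff) (auto intro: bdd_belowI[of _ 0])
    show "y \<in> ?U"
    proof (cases "j < N")
      case True
      then have "x j \<in> insert p (x ` {..<N})" by simp
      moreover have "y \<in> ball (x j) (2 * e)" using j e by (simp add: dist_commute)
      ultimately show ?thesis by blast
    next
      case False
      then have "dist p y < 2 * e"
        using tail[of j] j dist_triangle[of p y "x j"] by (simp add: dist_commute)
      then show ?thesis by simp
    qed
  qed
  then have "emeasure lebesgue (eps_nbhd e (range x)) \<le> emeasure lebesgue ?U"
    by (intro emeasure_mono) auto
  also have "\<dots> \<le> (\<Sum>c\<in>insert p (x ` {..<N}). emeasure lebesgue (ball c (2 * e)))"
    by (intro emeasure_subadditive_finite) auto
  also have "\<dots> = ennreal (real (card (insert p (x ` {..<N}))) * v)"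
    using v by (simp add: ball ennreal_mult' ennreal_of_nat_eq_real_of_nat del: card_insert_disjoint)
  also have "\<dots> \<le> ennreal ((real N + 1) * v)"
  proof (intro ennreal_leI mult_right_mono v)
    have "card (insert p (x ` {..<N})) \<le> Suc (card (x ` {..<N}))"
      by (rule card_insert_le_m1) auto
    also have "\<dots> \<le> Suc N" using card_image_le[of "{..<N}" x] by simp
    finally show "real (card (insert p (x ` {..<N}))) \<le> real N + 1" by simp
  qed
  finally show ?thesis by (simp add: v_def)
qed

lemma has_box_dim_0_geometric:
  fixes x :: "nat \<Rightarrow> 'a::euclidean_space"
  assumes conv: "\<And>j. dist (x j) p \<le> C * q ^ (j div m)"
    and C: "C > 0" and q: "0 < q" "q < 1" and m: "m > 0"
  shows "has_box_dim (range x) 0"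
proof (rule has_box_dim_0I)
  have "C * q ^ (j div m) \<le> C * 1" for j
    using C q by (intro mult_left_mono power_le_one) auto
  with conv have "dist (x j) p \<le> C" for j
    by (metis mult.right_neutral order.trans)
  then show "bounded (range x)"
    by (auto simp: bounded_def dist_commute intro!: exI[of _ p])
next
  fix s :: real assume s: "s > 0"
  define D where "D = DIM('a)"
  \<comment> \<open>Converts natural logarithms to base \<open>1 / q\<close>:
    \<open>C * q ^ Q < e\<close> amounts to \<open>Q > b * ln (C / e)\<close>.\<close>
  define b where "b = 1 / ln (1 / q)"
  have b: "b > 0" using q by (simp add: b_def)
  define V where "V = unit_ball_vol (real D) * 2 ^ D"
  have V: "V \<ge> 0" by (simp add: V_def)
  \<comment> \<open>The volume of at most \<open>m * (b * ln (C / e) + 2) + 1\<close> balls of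
    radius \<open>2 * e\<close>, divided by \<open>e powr (D - s)\<close>.\<close>
  define g where "g = (\<lambda>e::real. (real m * (b * ln (C / e) + 2) + 1) * V * e powr s)"
  have g: "(g \<longlongrightarrow> 0) (at_right 0)"
  proof -
    have "((\<lambda>e::real. e powr s) \<longlongrightarrow> 0) (at_right 0)" "((\<lambda>e::real. ln e * e powr s) \<longlongrightarrow> 0) (at_right 0)"
      using s by real_asymp+
    \<comment> \<open>Splitting \<open>ln (C / e)\<close> into \<open>ln C - ln e\<close> writes
      \<open>g\<close> as a combination of these two vanishing functions.\<close>
    from tendsto_diff[OF this[THEN tendsto_mult_left]]
    have "((\<lambda>e. (real m * (b * ln C + 2) + 1) * V * e powr s - real m * b * V * (ln e * e powr s))
        \<longlongrightarrow> (real m * (b * ln C + 2) + 1) * V * 0 - real m * b * V * 0) (at_right 0)" .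
    moreover have "\<forall>\<^sub>F e in at_right 0.
        (real m * (b * ln C + 2) + 1) * V * e powr s - real m * b * V * (ln e * e powr s) = g e"
      using eventually_at_right_less[of 0]
      by eventually_elim (use C in \<open>simp add: g_def ln_div algebra_simps\<close>)
    ultimately show ?thesis by (auto intro: Lim_transform_eventually)
  qed
  have bound: "emeasure lebesgue (eps_nbhd e (range x)) / ennreal (e powr (real D - s)) \<le> ennreal (g e)"
    if e: "0 < e" "e < C" for e
  proof -
    \<comment> \<open>Rounding down and adding 1 makes \<open>Q\<close> strictly exceed
      \<open>b * ln (C / e)\<close>; \<open>nat\<close> is harmless because \<open>e < C\<close>
      makes this nonnegative.\<close>
    define Q where "Q = nat \<lfloor>b * ln (C / e)\<rfloor> + 1"
    have pos: "b * ln (C / e) \<ge> 0" using b e by simp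
    have Q: "b * ln (C / e) < real Q" "real Q \<le> b * ln (C / e) + 2"
      using pos by (auto simp: Q_def) linarith+
    have "ln (C / e) < real Q * ln (1 / q)"
      using Q(1) q by (simp add: b_def field_simps)
    then have "ln (C * q ^ Q) < ln e"
      using C e q by (simp add: ln_div ln_mult ln_realpow algebra_simps)
    then have CQ: "C * q ^ Q < e" using C e q by (simp add: ln_less_cancel_iff)
    have tail: "dist (x j) p < e" if "j \<ge> m * Q" for j
    proof -
      have "j div m \<ge> Q" using that m by (simp add: less_eq_div_iff_mult_less_eq mult.commute)
      then have "C * q ^ (j div m) \<le> C * q ^ Q"
        using C q by (intro mult_left_mono power_decreasing) auto
      with conv[of j] CQ show ?thesis by linarith
    qed
    have "emeasure lebesgue (eps_nbhd e (range x)) \<le>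
        ennreal ((real (m * Q) + 1) * (unit_ball_vol (real D) * (2 * e) ^ D))"
      unfolding D_def by (rule emeasure_eps_nbhd_le[OF e(1) tail])
    also have "(real (m * Q) + 1) * (unit_ball_vol (real D) * (2 * e) ^ D) =
        (real m * real Q + 1) * V * e powr real D"
      using e by (simp add: V_def power_mult_distrib powr_realpow)
    also have "ennreal \<dots> \<le> ennreal ((real m * (b * ln (C / e) + 2) + 1) * V * e powr real D)"
      using Q(2) V by (intro ennreal_leI mult_right_mono add_mono mult_left_mono) auto
    also have "\<dots> = ennreal (g e * e powr (real D - s))"
      by (simp add: g_def mult.assoc flip: powr_add)
    finally have "emeasure lebesgue (eps_nbhd e (range x)) / ennreal (e powr (real D - s)) \<le>
        ennreal (g e * e powr (real D - s)) / ennreal (e powr (real D - s))"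
      by (rule divide_right_mono_ennreal)
    also have "\<dots> = ennreal (g e)"
      using e pos V by (subst divide_ennreal) (auto simp: g_def)
    finally show ?thesis .
  qed
  have "\<forall>\<^sub>F e in at_right 0. 0 < e \<and> e < C"
    using C by (auto simp: eventually_at_right_field)
  then have "\<forall>\<^sub>F e in at_right 0.
      emeasure lebesgue (eps_nbhd e (range x)) / ennreal (e powr (real D - s)) \<le> ennreal (g e)"
    by eventually_elim (use bound in auto)
  moreover have "((\<lambda>e. ennreal (g e)) \<longlongrightarrow> 0) (at_right 0)"
    using tendsto_ennrealI[OF g] by simp
  ultimately show "((\<lambda>e. emeasure lebesgue (eps_nbhd e (range x)) /
      ennreal (e powr (real DIM('a) - s))) \<longlongrightarrow> 0) (at_right 0)"
    unfolding D_def by (rule tendsto_sandwich[OF _ _ tendsto_const, rotated]) simp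
qed

section \<open>Choice of the radius and passage from the decay estimate to the orbit\<close>

theorem theorem2:
  fixes F :: "real ^ 'n \<Rightarrow> real ^ 'n" and x0 :: "real ^ 'n" and r :: real
  assumes "r > 0"
    and "C1_on F (ball x0 r)"
    and "F x0 = x0"
    and "\<forall>l. complex_eigenvalue (jacobian F (at x0)) l \<longrightarrow> cmod l < 1"
  shows "\<exists>r1. 0 < r1 \<and> r1 < r \<and>
    (\<forall>x1\<in>ball x0 r1. orbit_points F x1 \<subseteq> ball x0 r \<and> has_box_dim (orbit_points F x1) 0)"
proof -
  let ?A = "jacobian F (at x0)"
  have "F differentiable at x0"
    using assms(1,2) unfolding C1_on_def differentiable_def by (meson centre_in_ball)
  then have der: "(F has_derivative (*v) ?A) (at x0)"
    by (simp add: jacobian_works)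
  have lin: "linear ((*v) ?A ^^ j)" for j
    by (induction j) (simp_all only: funpow.simps linear_id linear_compose matrix_vector_mul_linear)
  have "\<forall>\<^sub>F j in sequentially. \<forall>h. norm (((*v) ?A ^^ j) h) \<le> 1 / 2 * norm h"
    using assms(4) by (intro linear_family_uniformly_small lin matrix_powers_tendsto_0) auto
  then obtain m d K where m: "m > 0" and d: "d > 0" and K: "K > 0"
    and conv: "\<And>x j. dist x x0 < d \<Longrightarrow> dist ((F ^^ j) x) x0 \<le> K * (3 / 4) ^ (j div m) * dist x x0"
    using orbits_converge_geometrically[OF assms(3) der] by blast
  \<comment> \<open>\<open>d\<close> gives access to the decay estimate, \<open>r / 2\<close> makes
    \<open>r1 < r\<close> strict, and \<open>r / K\<close> keeps the whole orbit within distance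
    \<open>r\<close>.\<close>
  define r1 where "r1 = Min {d, r / 2, r / K}"
  have r1: "0 < r1" "r1 < r" "r1 \<le> d" "K * r1 \<le> r"
  proof -
    have "r1 \<le> r / 2" "r1 \<le> r / K" "r1 \<le> d"
      unfolding r1_def by (intro Min_le; simp)+
    then show "r1 < r" "r1 \<le> d" "K * r1 \<le> r"
      using K assms(1) by (simp_all add: field_simps)
  qed (use d K assms(1) in \<open>simp add: r1_def\<close>)
  have "orbit_points F x1 \<subseteq> ball x0 r \<and> has_box_dim (orbit_points F x1) 0"
    if "x1 \<in> ball x0 r1" for x1
  proof
    have x1: "dist x1 x0 < r1" using that by (simp add: dist_commute)
    have dist: "dist ((F ^^ j) x1) x0 \<le> K * (3 / 4) ^ (j div m) * dist x1 x0" for j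
      using conv x1 r1 by auto
    \<comment> \<open>\<open>F\<close> is a total function here; that the orbit never leaves
      \<open>ball x0 r\<close> expresses that it is well defined for the map on the ball.\<close>
    have "dist ((F ^^ j) x1) x0 < r" for j
    proof -
      have "K * (3 / 4) ^ (j div m) * dist x1 x0 \<le> K * 1 * dist x1 x0"
        using K by (intro mult_right_mono mult_left_mono power_le_one) auto
      also have "\<dots> < K * r1" using K x1 by simp
      finally show ?thesis using dist[of j] r1 by linarith
    qed
    then show "orbit_points F x1 \<subseteq> ball x0 r"
      by (auto simp: orbit_points_def dist_commute)
    have "dist ((F ^^ j) x1) x0 \<le> K * r1 * (3 / 4) ^ (j div m)" for j
    proof -
      have "K * (3 / 4) ^ (j div m) * dist x1 x0 \<le> K * (3 / 4) ^ (j div m) * r1"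
        using K x1 by (intro mult_left_mono) auto
      with dist[of j] show ?thesis by (simp add: mult_ac)
    qed
    then show "has_box_dim (orbit_points F x1) 0"
      unfolding orbit_points_def using K r1 m
      by (intro has_box_dim_0_geometric[where p = x0 and C = "K * r1" and q = "3 / 4"]) auto
  qed
  with r1 show ?thesis by blast
qed

end
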